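(* Let $n\ge 1$ be an integer. For all $x,y\in\mathbb{R}^n$, we have $H_y=H_x$ if and only if $y=\gamma(x)$ for some $\gamma\in\mathsf{GL}(n,\mathbb{Z})$.
   Context: $\mathsf{GL}(n,\mathbb{Z})$ denotes the group of linear transformations $x\mapsto \mathcal{U}x$ of $\mathbb{R}^n$, where $\mathcal{U}$ is an integer $(n\times n)$-matrix with $\det(\mathcal{U})=\pm1$. For $x=(x_1,\ldots,x_n)\in\mathbb{R}^n$, $H_x=\mathbb{Z}x_1+\mathbb{Z}x_2+\cdots+\mathbb{Z}x_n$ is the subgroup of the additive group $\mathbb{R}$ generated by the coordinates $x_1,\ldots,x_n$; equality $H_y=H_x$ is equality as subsets of $\mathbb{R}$. *)

theory Defs
  imports "HOL-Analysis.Analysis" "HOL-Computational_Algebra.Group_Closure"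
begin

definition GL_int :: "(real ^ 'n \<Rightarrow> real ^ 'n) set" where
  "GL_int = {\<lambda>x. U *v x | U :: real ^ 'n ^ 'n.
     (\<forall>i j. U $ i $ j \<in> \<int>) \<and> (det U = 1 \<or> det U = - 1)}"

definition coord_group :: "real ^ 'n \<Rightarrow> real set" where
  "coord_group x = {\<Sum>i\<in>UNIV. of_int (k i) * x $ i | k :: 'n \<Rightarrow> int. True}"

lemma coord_group_eq_group_closure:
  fixes x :: "real ^ 'n"
  shows "coord_group x = group_closure (range (($) x))"
proof (intro equalityI subsetI)
  fix a assume "a \<in> coord_group x"
  then obtain k :: "'n \<Rightarrow> int" where a: "a = (\<Sum>i\<in>UNIV. of_int (k i) * x $ i)"
    by (auto simp: coord_group_def)
  have "of_int m * x $ i \<in> group_closure (range (($) x))" for m :: int and i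
  proof (cases m rule: int_cases2)
    case (nonneg n)
    then show ?thesis
      by (simp add: group_closure_scalar_mult_left group_closure.base)
  next
    case (nonpos n)
    then show ?thesis
      by (simp add: group_closure_scalar_mult_left group_closure.base)
  qed
  then have "(\<Sum>i\<in>I. of_int (k i) * x $ i) \<in> group_closure (range (($) x))" for I
    by (induction I rule: infinite_finite_induct) (simp_all add: group_closure_add)
  then show "a \<in> group_closure (range (($) x))"
    by (simp add: a)
next
  fix a assume "a \<in> group_closure (range (($) x))"
  then show "a \<in> coord_group x"
  proof induction
    case (base s)
    then consider "s = 0" | j where "s = x $ j" by auto
    then show ?case
    proof cases
      case 1
      then show ?thesis
        by (auto simp: coord_group_def intro!: exI[of _ "\<lambda>_. 0"])
    next
      case 2
      then show ?thesis
        by (auto simp: coord_group_def if_distrib[of of_int] if_distrib[of "\<lambda>c. c * _"]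
          cong: if_cong intro!: exI[of _ "\<lambda>i. if i = j then 1 else 0"])
    qed
  next
    case (diff s t)
    then obtain k l :: "'n \<Rightarrow> int" where
      "s = (\<Sum>i\<in>UNIV. of_int (k i) * x $ i)" "t = (\<Sum>i\<in>UNIV. of_int (l i) * x $ i)"
      by (auto simp: coord_group_def)
    then show ?case
      by (auto simp: coord_group_def left_diff_distrib sum_subtractf
        intro!: exI[of _ "\<lambda>i. k i - l i"])
  qed
qed

end

theory Submission
  imports Defs
begin

text \<open>
  Both sides are compatible with the action of unimodular matrices, so \<open>x\<close> and \<open>y\<close> may be
  replaced by normal forms. Applying elementary row operations along an integer relation between
  the nonzero coordinates shrinks the relation until a new zero coordinate appears; hence every
  orbit contains a vector whose nonzero coordinates are linearly independent over the integers.
  If two such vectors generate the same group, the integer matrices expressing their nonzero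
  coordinates through each other are mutually inverse. Comparing traces, the two supports have
  equal size, and any bijection between their complements completes the matrices to unimodular ones.
\<close>

section \<open>Integer matrices and the unimodular action\<close>

definition int_vec :: "real ^ 'n \<Rightarrow> bool" where
  "int_vec k \<longleftrightarrow> (\<forall>i. k $ i \<in> \<int>)"

definition int_mat :: "real ^ 'n ^ 'm \<Rightarrow> bool" where
  "int_mat U \<longleftrightarrow> (\<forall>i j. U $ i $ j \<in> \<int>)"

definition unimodular :: "real ^ 'n ^ 'n \<Rightarrow> bool" where
  "unimodular U \<longleftrightarrow> int_mat U \<and> (det U = 1 \<or> det U = - 1)"

definition GL_equiv :: "real ^ 'n \<Rightarrow> real ^ 'n \<Rightarrow> bool" where
  "GL_equiv x y \<longleftrightarrow> (\<exists>U. unimodular U \<and> y = U *v x)"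

definition supp :: "real ^ 'n \<Rightarrow> 'n set" where
  "supp x = {i. x $ i \<noteq> 0}"

text \<open>Entries of \<open>k\<close> off the support do not affect \<open>k \<bullet> x\<close>,
  so they must be left free: this is linear independence over the integers of the indexed family of
  nonzero coordinates.\<close>

definition indep_support :: "real ^ 'n \<Rightarrow> bool" where
  "indep_support x \<longleftrightarrow> (\<forall>k. int_vec k \<longrightarrow> k \<bullet> x = 0 \<longrightarrow> (\<forall>i\<in>supp x. k $ i = 0))"

lemma matrix_add_rdistrib: "(A + B) ** C = A ** C + B ** C"
  by (vector matrix_matrix_mult_def sum.distrib distrib_right)

lemma int_mat_mult: "int_mat A \<Longrightarrow> int_mat B \<Longrightarrow> int_mat (A ** B)"
  by (auto simp: int_mat_def matrix_matrix_mult_def)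

lemma int_vec_mult: "int_vec k \<Longrightarrow> int_mat A \<Longrightarrow> int_vec (k v* A)"
  by (auto simp: int_mat_def int_vec_def vector_matrix_mult_def)

lemma det_Ints:
  assumes "int_mat A"
  shows "det A \<in> \<int>"
  using assms unfolding det_def int_mat_def
  by (auto intro!: Ints_sum Ints_mult Ints_prod)

lemma unimodularI:
  assumes "int_mat A" "int_mat B" "A ** B = mat 1"
  shows "unimodular A"
proof -
  obtain a b where ab: "det A = of_int a" "det B = of_int b"
    using det_Ints assms by (metis Ints_cases)
  have "det A * det B = 1"
    using assms(3) by (metis det_I det_mul)
  then have "a * b = 1"
    unfolding ab by (metis of_int_eq_1_iff of_int_mult)
  then show ?thesis
    using assms ab by (auto simp: unimodular_def zmult_eq_1_iff)
qed

text \<open>By Cramer's rule each entry of the inverse is an integer determinant divided by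
  \<open>det U\<close>, which is 1 or -1.\<close>

lemma unimodular_inverse:
  assumes "unimodular U"
  obtains V where "unimodular V" "V ** U = mat 1"
proof -
  have d: "det U = 1 \<or> det U = -1" and U: "int_mat U"
    using assms by (auto simp: unimodular_def)
  then have "invertible U"
    by (auto simp: invertible_det_nz)
  then obtain V where V: "U ** V = mat 1" "V ** U = mat 1"
    by (auto simp: invertible_def)
  have "V $ k $ l \<in> \<int>" for k l
  proof -
    have "U *v column l V = axis l 1"
      by (metis V(1) matrix_vector_mul_assoc matrix_vector_mul_lid matrix_vector_mult_basis)
    then have "column l V $ k =
        det (\<chi> i j. if j = k then axis l 1 $ i else U $ i $ j) / det U"
      using d by (subst (asm) cramer) auto
    moreover have "det (\<chi> i j. if j = k then axis l 1 $ i else U $ i $ j) \<in> \<int>"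
      using U by (intro det_Ints) (auto simp: int_mat_def axis_def)
    ultimately show ?thesis
      using d by (auto simp: column_def)
  qed
  then have "unimodular V"
    using U V by (intro unimodularI[of V U]) (auto simp: int_mat_def)
  then show ?thesis
    using V that by blast
qed

lemma GL_equiv_refl: "GL_equiv x x"
  unfolding GL_equiv_def unimodular_def int_mat_def
  by (intro exI[of _ "mat 1"]) (simp, simp add: mat_def)

lemma GL_equiv_trans: "GL_equiv x y \<Longrightarrow> GL_equiv y z \<Longrightarrow> GL_equiv x z"
  unfolding GL_equiv_def unimodular_def
  by (metis (no_types, lifting) det_mul int_mat_mult matrix_vector_mul_assoc
      mult_1 mult_minus1 minus_minus)

lemma GL_equiv_sym: "GL_equiv x y \<Longrightarrow> GL_equiv y x"
  unfolding GL_equiv_def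
  by (metis unimodular_inverse matrix_vector_mul_assoc matrix_vector_mul_lid)

lemma GL_equiv_transvection:
  fixes z :: "real ^ 'n"
  assumes "i \<noteq> j"
  shows "GL_equiv z (\<chi> l. if l = j then z $ j + of_int c * z $ i else z $ l)"
proof -
  define U :: "real ^ 'n ^ 'n" where
    "U = (\<chi> l. if l = j then row j (mat 1) + of_int c *s row i (mat 1) else row l (mat 1))"
  have "det U = 1"
    unfolding U_def using assms by (subst det_row_operation) auto
  moreover have "int_mat U"
    by (auto simp: int_mat_def U_def row_def mat_def)
  moreover have "(U *v z) $ l = (if l = j then z $ j + of_int c * z $ i else z $ l)" for l
    by (auto simp: U_def matrix_vector_mult_def row_def mat_def distrib_right sum.distrib
        if_distrib[of "\<lambda>c. c * _"] if_distrib[of "\<lambda>c. _ * c"] cong: if_cong)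
  ultimately show ?thesis
    unfolding GL_equiv_def unimodular_def
    by (intro exI[of _ U]) (simp add: vec_eq_iff)
qed

section \<open>Invariance of the coordinate group\<close>

text \<open>In inner product form, a matrix acting on \<open>x\<close> can be moved over to the
  coefficient vector.\<close>

lemma mem_coord_group_iff: "a \<in> coord_group x \<longleftrightarrow> (\<exists>k. int_vec k \<and> a = k \<bullet> x)"
proof
  assume "a \<in> coord_group x"
  then obtain k where "a = (\<Sum>i\<in>UNIV. of_int (k i) * x $ i)"
    by (auto simp: coord_group_def)
  then show "\<exists>k. int_vec k \<and> a = k \<bullet> x"
    by (intro exI[of _ "\<chi> i. of_int (k i)"]) (auto simp: int_vec_def inner_vec_def)
next
  assume "\<exists>k. int_vec k \<and> a = k \<bullet> x"
  then obtain k where k: "int_vec k" "a = k \<bullet> x"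
    by blast
  then have "k $ i = of_int \<lfloor>k $ i\<rfloor>" for i
    by (simp add: int_vec_def)
  then have "a = (\<Sum>i\<in>UNIV. of_int \<lfloor>k $ i\<rfloor> * x $ i)"
    using k by (simp add: inner_vec_def)
  then show "a \<in> coord_group x"
    unfolding coord_group_def by (intro CollectI exI[of _ "\<lambda>i. \<lfloor>k $ i\<rfloor>"]) simp
qed

lemma coord_group_mult_subset: "int_mat U \<Longrightarrow> coord_group (U *v x) \<subseteq> coord_group x"
  by (auto simp: mem_coord_group_iff) (metis dot_lmul_matrix int_vec_mult)

lemma GL_equiv_coord_group: "GL_equiv x y \<Longrightarrow> coord_group x = coord_group y"
proof -
  have "coord_group y \<subseteq> coord_group x" if "GL_equiv x y" for x y :: "real ^ 'n"
    using that coord_group_mult_subset by (auto simp: GL_equiv_def unimodular_def)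
  then show "GL_equiv x y \<Longrightarrow> coord_group x = coord_group y" for x y :: "real ^ 'n"
    using GL_equiv_sym by blast
qed

section \<open>Reduction to independent nonzero coordinates\<close>

text \<open>Euclidean descent on the sum of the absolute values of the coefficients: each
  transvection either kills a coordinate or keeps the support and leaves a strictly smaller
  relation.\<close>

lemma relation_reduces_support:
  fixes z :: "real ^ 'n" and k :: "'n \<Rightarrow> int"
  assumes "\<And>i. k i \<noteq> 0 \<Longrightarrow> i \<in> supp z" "(\<Sum>i\<in>UNIV. of_int (k i) * z $ i) = 0" "k a \<noteq> 0"
  shows "\<exists>w. GL_equiv z w \<and> card (supp w) < card (supp z)"
  using assms
proof (induction "\<Sum>i\<in>UNIV. nat \<bar>k i\<bar>" arbitrary: z k a rule: less_induct)
  case (less k z a)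
  \<comment> \<open>A relation with \<open>k a\<close> as its only nonzero coefficient would force
    \<open>z $ a = 0\<close>.\<close>
  have "\<exists>b. b \<noteq> a \<and> k b \<noteq> 0"
  proof (rule ccontr)
    assume "\<not> ?thesis"
    then have "(\<Sum>i\<in>UNIV. of_int (k i) * z $ i) = (\<Sum>i\<in>{a}. of_int (k i) * z $ i)"
      by (intro sum.mono_neutral_right) auto
    then show False
      using less.prems by (auto simp: supp_def)
  qed
  then obtain b where "b \<noteq> a" "k b \<noteq> 0"
    by blast
  then obtain i j where ij: "i \<noteq> j" "k j \<noteq> 0" "\<bar>k j\<bar> \<le> \<bar>k i\<bar>"
    using less.prems(3) by (metis linear)
  \<comment> \<open>With this sign, \<open>k i - c * k j\<close> has absolute value
    \<open>\<bar>k i\<bar> - \<bar>k j\<bar>\<close>. Adding \<open>c * z $ i\<close> to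
    \<open>z $ j\<close> compensates for the change of coefficient, so the relation
    persists.\<close>
  define c where "c = sgn (k i) * sgn (k j)"
  define k' where "k' = k(i := k i - c * k j)"
  define w where "w = (\<chi> l. if l = j then z $ j + of_int c * z $ i else z $ l)"
  have equiv: "GL_equiv z w"
    unfolding w_def by (rule GL_equiv_transvection) (use ij in auto)
  have ki: "k i \<noteq> 0"
    using ij by auto
  then have z: "i \<in> supp z" "j \<in> supp z"
    using less.prems ij by auto
  show ?case
  proof (cases "w $ j = 0")
    case True
    then have "supp w \<subset> supp z"
      using z by (auto simp: supp_def w_def split: if_splits)
    then show ?thesis
      using equiv by (meson finite psubset_card_mono)
  next
    case False
    then have supp: "supp w = supp z"
      using z by (auto simp: supp_def w_def)
    have split: "sum f UNIV = f i + f j + sum f (UNIV - {i} - {j})"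
      for f :: "'n \<Rightarrow> 'a :: comm_monoid_add"
      using ij by (simp add: sum.remove[of UNIV i] sum.remove[of "UNIV - {i}" j] add.assoc)
    have "\<bar>k' i\<bar> < \<bar>k i\<bar>"
      using ij ki by (auto simp: k'_def c_def sgn_if)
    then have "(\<Sum>l\<in>UNIV. nat \<bar>k' l\<bar>) < (\<Sum>l\<in>UNIV. nat \<bar>k l\<bar>)"
      by (intro sum_strict_mono_ex1) (auto simp: k'_def)
    moreover have "l \<in> supp w" if "k' l \<noteq> 0" for l
      using that less.prems z by (auto simp: supp k'_def split: if_splits)
    moreover have "(\<Sum>l\<in>UNIV. of_int (k' l) * w $ l) = 0"
    proof -
      have "(\<Sum>l\<in>UNIV - {i} - {j}. of_int (k' l) * w $ l)
          = (\<Sum>l\<in>UNIV - {i} - {j}. of_int (k l) * z $ l)"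
        by (intro sum.cong) (auto simp: k'_def w_def)
      then have "(\<Sum>l\<in>UNIV. of_int (k' l) * w $ l) = (\<Sum>l\<in>UNIV. of_int (k l) * z $ l)"
        using ij by (simp add: split k'_def w_def algebra_simps)
      then show ?thesis
        using less.prems by simp
    qed
    \<comment> \<open>The index \<open>j\<close> replaces \<open>a\<close> in the induction
      hypothesis; \<open>k' i\<close> may be zero.\<close>
    moreover have "k' j \<noteq> 0"
      using ij by (simp add: k'_def)
    ultimately obtain v where "GL_equiv w v" "card (supp v) < card (supp w)"
      using less.hyps by blast
    then show ?thesis
      using equiv supp GL_equiv_trans by metis
  qed
qed

lemma GL_equiv_indep_support: "\<exists>z. GL_equiv x z \<and> indep_support z"
proof (induction "card (supp x)" arbitrary: x rule: less_induct)
  case less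
  show ?case
  proof (cases "indep_support x")
    case True
    then show ?thesis
      using GL_equiv_refl by blast
  next
    case False
    then obtain k a where k: "int_vec k" "k \<bullet> x = 0" "a \<in> supp x" "k $ a \<noteq> 0"
      by (auto simp: indep_support_def)
    \<comment> \<open>The descent needs coefficients supported on \<open>supp x\<close>; clearing
      the others changes no summand. The floor merely turns integral reals into integers.\<close>
    define m where "m i = (if i \<in> supp x then \<lfloor>k $ i\<rfloor> else 0)" for i
    have "of_int (m i) * x $ i = k $ i * x $ i" for i
      using k by (auto simp: m_def int_vec_def supp_def)
    then have "(\<Sum>i\<in>UNIV. of_int (m i) * x $ i) = 0"
      using k(2) unfolding inner_vec_def by (simp only: inner_real_def)
    moreover have "of_int (m a) = k $ a"
      using k by (simp add: m_def int_vec_def)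
    then have "m a \<noteq> 0"
      using k by auto
    moreover have "i \<in> supp x" if "m i \<noteq> 0" for i
      using that by (auto simp: m_def split: if_splits)
    ultimately obtain w where "GL_equiv x w" "card (supp w) < card (supp x)"
      using relation_reduces_support[of m x a] by blast
    then show ?thesis
      using less GL_equiv_trans by blast
  qed
qed

section \<open>Independent vectors with the same group\<close>

text \<open>Entries in rows with \<open>z $ i = 0\<close> or columns with \<open>w $ j = 0\<close>
  can be cleared without spoiling \<open>z = A *v w\<close>. This leaves room to complete the matrix
  later.\<close>

lemma coefficient_matrix:
  fixes z w :: "real ^ 'n"
  assumes "coord_group z \<subseteq> coord_group w"
  obtains A where "int_mat A" "z = A *v w"
    "\<And>i j. i \<notin> supp z \<or> j \<notin> supp w \<Longrightarrow> A $ i $ j = 0"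
proof -
  have "\<exists>k. int_vec k \<and> z $ i = k \<bullet> w" for i
  proof -
    have "z $ i = axis i 1 \<bullet> z"
      by (simp add: inner_axis')
    moreover have "int_vec (axis i (1 :: real))"
      by (simp add: int_vec_def axis_def)
    ultimately have "z $ i \<in> coord_group z"
      using mem_coord_group_iff by blast
    then show ?thesis
      using assms mem_coord_group_iff by blast
  qed
  then obtain k where k: "int_vec (k i)" "z $ i = k i \<bullet> w" for i
    by metis
  define A where "A = (\<chi> i j. if i \<in> supp z \<and> j \<in> supp w then k i $ j else 0)"
  have "z $ i = (A *v w) $ i" for i
  proof (cases "i \<in> supp z")
    case True
    then show ?thesis
      unfolding k(2) inner_vec_def matrix_vector_mult_def
      by (auto simp: A_def supp_def intro!: sum.cong)
  next
    case False
    then show ?thesis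
      by (auto simp: A_def supp_def matrix_vector_mult_def)
  qed
  then have "z = A *v w"
    unfolding vec_eq_iff by blast
  moreover have "int_mat A"
    using k(1) by (auto simp: A_def int_mat_def int_vec_def)
  moreover have "A $ i $ j = 0" if "i \<notin> supp z \<or> j \<notin> supp w" for i j
    using that by (auto simp: A_def)
  ultimately show ?thesis
    using that by blast
qed

lemma coefficient_matrices_inverse:
  fixes w :: "real ^ 'n" and A B :: "real ^ 'n ^ 'n"
  assumes "indep_support w" "int_mat A" "int_mat B" "w = B *v (A *v w)"
    and "\<And>i j. j \<notin> supp w \<Longrightarrow> A $ i $ j = 0" "\<And>i j. i \<notin> supp w \<Longrightarrow> B $ i $ j = 0"
  shows "B ** A = (\<chi> i j. if i = j \<and> i \<in> supp w then 1 else 0)"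
proof -
  have "(B ** A) $ i $ j = (if i = j \<and> i \<in> supp w then 1 else 0)" for i j
  proof (cases "i \<in> supp w \<and> j \<in> supp w")
    case True
    \<comment> \<open>Since \<open>B ** A\<close> fixes \<open>w\<close>, this difference is an
      integer relation on \<open>w\<close>, so it vanishes on the support.\<close>
    define k where "k = row i (B ** A) - axis i 1"
    have "int_vec k"
      using int_mat_mult[OF assms(3,2)]
      by (auto simp: k_def int_vec_def int_mat_def row_def axis_def)
    moreover have "row i (B ** A) \<bullet> w = w $ i"
      by (metis assms(4) matrix_vector_mul_assoc matrix_vector_mul_component row_def vec_nth_inverse)
    then have "k \<bullet> w = 0"
      by (simp add: k_def inner_diff_left inner_axis')
    ultimately have "k $ j = 0"
      using assms(1) True by (auto simp: indep_support_def)
    then show ?thesis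
      using True by (auto simp: k_def row_def axis_def)
  next
    case False
    then show ?thesis
      using assms(5,6) by (auto simp: matrix_matrix_mult_def)
  qed
  then show ?thesis
    by (simp add: vec_eq_iff)
qed

lemma GL_equiv_if_indep_support:
  fixes z w :: "real ^ 'n"
  assumes "coord_group z = coord_group w" "indep_support z" "indep_support w"
  shows "GL_equiv w z"
proof -
  obtain A where A: "int_mat A" "z = A *v w"
    "\<And>i j. i \<notin> supp z \<or> j \<notin> supp w \<Longrightarrow> A $ i $ j = 0"
    using coefficient_matrix[of z w] assms by blast
  obtain B where B: "int_mat B" "w = B *v z"
    "\<And>i j. i \<notin> supp w \<or> j \<notin> supp z \<Longrightarrow> B $ i $ j = 0"
    using coefficient_matrix[of w z] assms by blast
  have BA: "B ** A = (\<chi> i j. if i = j \<and> i \<in> supp w then 1 else 0)"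
    using A B assms by (intro coefficient_matrices_inverse) auto
  have AB: "A ** B = (\<chi> i j. if i = j \<and> i \<in> supp z then 1 else 0)"
    using A B assms by (intro coefficient_matrices_inverse) auto
  \<comment> \<open>Both products are diagonal 0/1 matrices, so their traces count the two
    supports.\<close>
  have "trace (B ** A) = trace (A ** B)"
    by (rule trace_mul_sym)
  then have "card (supp w) = card (supp z)"
    by (simp add: BA AB trace_def flip: sum.inter_filter)
  then have "card (- supp z) = card (- supp w)"
    unfolding Compl_eq_Diff_UNIV by (simp only: card_Diff_subset finite subset_UNIV)
  then obtain p where p: "bij_betw p (- supp z) (- supp w)"
    by (meson finite finite_same_card_bij)
  \<comment> \<open>A partial permutation matrix matching the zero coordinates of \<open>z\<close>
    with those of \<open>w\<close>. It lives in the block complementary to that of \<open>A\<close>,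
    so the cross terms of \<open>(A + P) ** (B + transpose P)\<close> vanish, and
    \<open>P ** transpose P\<close> supplies the diagonal ones missing from
    \<open>A ** B\<close>.\<close>
  define P :: "real ^ 'n ^ 'n" where "P = (\<chi> i j. if i \<notin> supp z \<and> j = p i then 1 else 0)"
  have P0: "P $ i $ j = 0" if "i \<in> supp z \<or> j \<in> supp w" for i j
    using that p by (auto simp: P_def bij_betw_def)
  have "A $ i $ l * P $ j $ l = 0" "P $ i $ l * B $ l $ j = 0" for i j l
    using A(3) B(3) P0 by (metis mult_eq_0_iff)+
  then have "A ** transpose P = 0" "P ** B = 0"
    unfolding vec_eq_iff by (auto simp: matrix_matrix_mult_def transpose_def intro!: sum.neutral)
  moreover have "(P ** transpose P) $ i $ j = (if i = j \<and> i \<notin> supp z then 1 else 0)" for i j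
  proof -
    have "(P ** transpose P) $ i $ j =
        (\<Sum>l\<in>UNIV. if l = p i
          then (if i \<notin> supp z \<and> j \<notin> supp z \<and> p i = p j then 1 else 0) else 0)"
      unfolding matrix_matrix_mult_def vec_lambda_beta
      by (intro sum.cong refl) (auto simp: P_def transpose_def)
    then show ?thesis
      using p by (auto simp: bij_betw_def inj_on_def)
  qed
  ultimately have "(A + P) ** (B + transpose P) = mat 1"
    by (simp add: matrix_add_ldistrib matrix_add_rdistrib AB) (auto simp: vec_eq_iff mat_def)
  then have "unimodular (A + P)"
    by (rule unimodularI[rotated 2])
      (use A(1) B(1) in \<open>auto simp: int_mat_def P_def transpose_def\<close>)
  \<comment> \<open>\<open>P\<close> only reads zero coordinates of \<open>w\<close>, so the
    completed matrix still sends \<open>w\<close> to \<open>z\<close>.\<close>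
  moreover have "P *v w = 0"
    using P0 by (auto simp: vec_eq_iff matrix_vector_mult_def supp_def intro!: sum.neutral)
  then have "z = (A + P) *v w"
    using A(2) by (simp add: matrix_vector_mult_add_rdistrib)
  ultimately show ?thesis
    unfolding GL_equiv_def by blast
qed

theorem proposition1:
  fixes x y :: "real ^ 'n"
  shows "coord_group y = coord_group x \<longleftrightarrow> (\<exists>\<gamma>\<in>GL_int. y = \<gamma> x)"
proof -
  have "coord_group y = coord_group x \<longleftrightarrow> GL_equiv x y"
  proof
    assume H: "coord_group y = coord_group x"
    obtain z w where z: "GL_equiv x z" "indep_support z" and w: "GL_equiv y w" "indep_support w"
      using GL_equiv_indep_support by metis
    then have "coord_group w = coord_group z"
      using H GL_equiv_coord_group by metis
    then have "GL_equiv z w"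
      using z w GL_equiv_if_indep_support by blast
    then show "GL_equiv x y"
      using z w GL_equiv_sym GL_equiv_trans by blast
  qed (use GL_equiv_coord_group in blast)
  also have "\<dots> \<longleftrightarrow> (\<exists>\<gamma>\<in>GL_int. y = \<gamma> x)"
    by (auto simp: GL_equiv_def GL_int_def unimodular_def int_mat_def)
  finally show ?thesis .
qed

end
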